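(* Let $H:\overline{\mathcal{M}}_1\to\overline{\mathcal{M}}_1$ be the hessian dynamical system on the compactified moduli space of elliptic curves, and identify $\overline{\mathcal{M}}_1$ with $\mathbb{P}^1=\mathbb{C}\cup\{\infty\}$ by means of the coordinate $h$ defined by $j=2^6\cdot 3^3\cdot h$, where $j$ is the $j$-invariant. Then: 1. Set-theoretically, the critical locus of $H$ is $\mathrm{Crit}(H)=\{h=4,\ h=-8,\ h=0\}$. 2. The set of critical values of $H$ (its discriminant locus) is $\Delta(H)=\{h=0,\ h=1,\ h=\infty\}$. 3. Seen as divisors, the critical fibers of $H$ are $$H^{*}(0)=3\,(h=4),\qquad H^{*}(1)=2\,(h=-8)+(h=1),\qquad H^{*}(\infty)=2\,(h=0)+(h=\infty),$$ where $H^*(c)$ denotes the fiber of $H$ over the point $h=c$, viewed as an effective divisor (points counted with multiplicity), and $(h=a)$ denotes the point of $\mathbb{P}^1$ where $h$ takes the value $a\in\mathbb{C}\cup\{\infty\}$.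
   Context: Everything is over $\mathbb{C}$. For a homogeneous polynomial $f\in\mathbb{C}[x,y,z]$, $\mathrm{Hess}(f)$ is the determinant of the $3\times 3$ matrix of second partial derivatives of $f$. For a plane projective curve $C=Z(f)\subset\mathbb{P}^2$, $\mathrm{Hess}(C)$ is the curve defined by $\mathrm{Hess}(f)$; if $C$ is a cubic, $\mathrm{Hess}(f)$ again has degree $3$. The $j$-invariant is normalized so that the elliptic curve with affine equation $y^2=4x^3-g_2x-g_3$ (with $g_2^3-27g_3^2\neq 0$) has $j=1728\, g_2^3/(g_2^3-27g_3^2)$. The coarse moduli space $\mathcal{M}_1$ of elliptic curves is identified with the affine line with coordinate $j$, and $\overline{\mathcal{M}}_1\simeq\mathbb{P}^1$ is its compactification by one point $j=\infty$. The hessian dynamical system is the algebraic map $H:\overline{\mathcal{M}}_1\to\overline{\mathcal{M}}_1$ which associates to each elliptic curve the isomorphism type of the hessian of a smooth plane cubic corresponding to it. That is, $H$ is the unique algebraic morphism $\mathbb{P}^1\to\mathbb{P}^1$ such that $H(j(C))=j(\mathrm{Hess}(C))$ for every smooth plane cubic $C$ whose hessian curve $\mathrm{Hess}(C)$ is smooth. In terms of $h$ it is expressed by $h\mapsto -\frac{1}{27}\cdot\frac{(h-4)^3}{h^2}$. *)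

theory Defs
  imports
    "HOL-Complex_Analysis.Complex_Analysis"
    "HOL-Library.Poly_Mapping"
    "HOL-Library.Numeral_Type"
begin

section \<open>Ternary forms and plane cubics\<close>

text \<open>
  Polynomials in \<open>\<complex>[x, y, z]\<close>: a monomial is a map from the three variables, indexed by the
  three-element type \<open>3\<close>, to exponents. The ring structure is the convolution product of
  \<^theory>\<open>HOL-Library.Poly_Mapping\<close>.
\<close>

type_synonym ternary_poly = "(3 \<Rightarrow>\<^sub>0 nat) \<Rightarrow>\<^sub>0 complex"

definition const_poly :: "complex \<Rightarrow> ternary_poly" where
  "const_poly c = Poly_Mapping.single 0 c"

definition var_poly :: "3 \<Rightarrow> ternary_poly" where
  "var_poly i = Poly_Mapping.single (Poly_Mapping.single i 1) 1"

definition eval_poly :: "ternary_poly \<Rightarrow> complex ^ 3 \<Rightarrow> complex" where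
  "eval_poly f v =
     (\<Sum>m\<in>Poly_Mapping.keys f. Poly_Mapping.lookup f m * (\<Prod>i\<in>UNIV. (v $ i) ^ Poly_Mapping.lookup m i))"

definition homogeneous :: "nat \<Rightarrow> ternary_poly \<Rightarrow> bool" where
  "homogeneous d f \<longleftrightarrow>
     (\<forall>m\<in>Poly_Mapping.keys f. (\<Sum>i\<in>UNIV. Poly_Mapping.lookup m i) = d)"

text \<open>
  If the variable \<open>i\<close> does not occur in a monomial, the truncated subtraction of exponents is
  harmless: the coefficient in front is then zero.
\<close>

definition partial_deriv :: "3 \<Rightarrow> ternary_poly \<Rightarrow> ternary_poly" where
  "partial_deriv i f =
     (\<Sum>m\<in>Poly_Mapping.keys f.
        Poly_Mapping.single (m - Poly_Mapping.single i 1)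
          (of_nat (Poly_Mapping.lookup m i) * Poly_Mapping.lookup f m))"

definition Hess :: "ternary_poly \<Rightarrow> ternary_poly" where
  "Hess f = det (\<chi> i j. partial_deriv i (partial_deriv j f))"

text \<open>
  The curve \<open>Z(f)\<close> is a smooth plane cubic. The zero form is excluded, since all its points
  are singular.
\<close>

definition smooth_cubic :: "ternary_poly \<Rightarrow> bool" where
  "smooth_cubic f \<longleftrightarrow> homogeneous 3 f \<and>
     \<not> (\<exists>v. v \<noteq> 0 \<and> eval_poly f v = 0 \<and> (\<forall>i. eval_poly (partial_deriv i f) v = 0))"

text \<open>The projective closure of the affine curve \<open>y\<^sup>2 = 4x\<^sup>3 - g\<^sub>2x - g\<^sub>3\<close>.\<close>

definition weierstrass_cubic :: "complex \<Rightarrow> complex \<Rightarrow> ternary_poly" where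
  "weierstrass_cubic g2 g3 =
     (let x = var_poly 1; y = var_poly 2; z = var_poly 3
      in y ^ 2 * z - (4 * x ^ 3 - const_poly g2 * x * z ^ 2 - const_poly g3 * z ^ 3))"

text \<open>
  A linear change of coordinates carries the curve \<open>Z(g)\<close> to \<open>Z(f)\<close>. Over the infinite field
  \<open>\<complex>\<close>, equality of values everywhere is equality of polynomials; the factor \<open>c\<close> reflects
  that a curve determines its equation only up to a nonzero scalar.
\<close>

definition projectively_equivalent :: "ternary_poly \<Rightarrow> ternary_poly \<Rightarrow> bool" where
  "projectively_equivalent f g \<longleftrightarrow>
     (\<exists>(A :: complex ^ 3 ^ 3) c. invertible A \<and> c \<noteq> 0 \<and>
        (\<forall>v. eval_poly f (A *v v) = c * eval_poly g v))"

text \<open>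
  The number \<open>j\<close> is the \<open>j\<close>-invariant of the cubic \<open>Z(f)\<close>. Every smooth plane cubic can be
  brought into Weierstrass form by a projective change of coordinates, and two smooth plane
  cubics are isomorphic as curves iff they are projectively equivalent, so each smooth cubic has
  exactly one such \<open>j\<close>, the one of its isomorphism class.
\<close>

definition has_j_invariant :: "ternary_poly \<Rightarrow> complex \<Rightarrow> bool" where
  "has_j_invariant f j \<longleftrightarrow>
     (\<exists>g2 g3. g2 ^ 3 - 27 * g3 ^ 2 \<noteq> 0 \<and> projectively_equivalent f (weierstrass_cubic g2 g3) \<and>
        j = 1728 * g2 ^ 3 / (g2 ^ 3 - 27 * g3 ^ 2))"


section \<open>Morphisms of the projective line\<close>

text \<open>\<open>\<complex> \<union> {\<infinity>}\<close>, with \<open>\<infinity>\<close> represented by \<^const>\<open>None\<close>.\<close>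

type_synonym proj_line = "complex option"

abbreviation infty :: proj_line where "infty \<equiv> None"

text \<open>The point with homogeneous coordinates \<open>[s : t]\<close>; the pair \<open>(0, 0)\<close> must be excluded.\<close>

definition proj_point :: "complex \<Rightarrow> complex \<Rightarrow> proj_line" where
  "proj_point s t = (if t = 0 then infty else Some (s / t))"

text \<open>The value at \<open>(s, t)\<close> of the binary form of degree \<open>d\<close> whose dehomogenization is \<open>p\<close>.\<close>

definition eval_binary_form :: "nat \<Rightarrow> complex poly \<Rightarrow> complex \<Rightarrow> complex \<Rightarrow> complex" where
  "eval_binary_form d p s t = (\<Sum>i\<le>d. poly.coeff p i * s ^ i * t ^ (d - i))"

text \<open>
  Morphisms \<open>\<P>\<^sup>1 \<rightarrow> \<P>\<^sup>1\<close> are the maps \<open>[s : t] \<mapsto> [P(s, t) : Q(s, t)]\<close> with \<open>P\<close> and \<open>Q\<close> binary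
  forms of the same degree without common zero.
\<close>

definition algebraic_morphism :: "(proj_line \<Rightarrow> proj_line) \<Rightarrow> bool" where
  "algebraic_morphism F \<longleftrightarrow>
     (\<exists>d p q. Polynomial.degree p \<le> d \<and> Polynomial.degree q \<le> d \<and> (\<forall>s t. (s, t) \<noteq> (0, 0) \<longrightarrow>
        (eval_binary_form d p s t, eval_binary_form d q s t) \<noteq> (0, 0) \<and>
        F (proj_point s t) = proj_point (eval_binary_form d p s t) (eval_binary_form d q s t)))"

text \<open>Standard local parametrization of the projective line sending \<open>0\<close> to the given point.\<close>

fun chart :: "proj_line \<Rightarrow> complex \<Rightarrow> proj_line" where
  "chart (Some a) t = Some (a + t)"
| "chart None t = proj_point 1 t"

text \<open>
  The local coordinate at the given point that is inverse to its chart. Only its germ at that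
  point is meaningful; the values outside the image of the chart are irrelevant.
\<close>

fun local_coord :: "proj_line \<Rightarrow> proj_line \<Rightarrow> complex" where
  "local_coord (Some c) (Some w) = w - c"
| "local_coord (Some c) None = 0"
| "local_coord None (Some w) = 1 / w"
| "local_coord None None = 0"

definition local_expr :: "(proj_line \<Rightarrow> proj_line) \<Rightarrow> proj_line \<Rightarrow> complex \<Rightarrow> complex" where
  "local_expr F a = (\<lambda>t. local_coord (F a) (F (chart a t)))"

text \<open>The points where the differential vanishes.\<close>

definition critical_locus :: "(proj_line \<Rightarrow> proj_line) \<Rightarrow> proj_line set" where
  "critical_locus F = {a. deriv (local_expr F a) 0 = 0}"

definition discriminant_locus :: "(proj_line \<Rightarrow> proj_line) \<Rightarrow> proj_line set" where
  "discriminant_locus F = F ` critical_locus F"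

text \<open>
  Divisors are elements of the free abelian group on the points. The multiplicity of a point of
  the fiber over \<open>c\<close> is the vanishing order there of the pullback of the local coordinate at
  \<open>c\<close>. This is meaningful for nonconstant morphisms.
\<close>

definition fiber_divisor :: "(proj_line \<Rightarrow> proj_line) \<Rightarrow> proj_line \<Rightarrow> (proj_line \<Rightarrow>\<^sub>0 int)" where
  "fiber_divisor F c =
     Poly_Mapping.Abs_poly_mapping (\<lambda>a. if F a = c then zorder (local_expr F a) 0 else 0)"


section \<open>The hessian dynamical system\<close>

text \<open>In terms of the coordinate \<open>j\<close>.\<close>

definition is_hessian_system :: "(proj_line \<Rightarrow> proj_line) \<Rightarrow> bool" where
  "is_hessian_system F \<longleftrightarrow> algebraic_morphism F \<and>
     (\<forall>f j j'. smooth_cubic f \<longrightarrow> smooth_cubic (Hess f) \<longrightarrow>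
        has_j_invariant f j \<longrightarrow> has_j_invariant (Hess f) j' \<longrightarrow> F (Some j) = Some j')"

definition hessian_system_j :: "proj_line \<Rightarrow> proj_line" where
  "hessian_system_j = (THE F. is_hessian_system F)"

text \<open>In terms of the coordinate \<open>h\<close> with \<open>j = 2\<^sup>6 \<cdot> 3\<^sup>3 \<cdot> h\<close>.\<close>

definition j_of_h :: "proj_line \<Rightarrow> proj_line" where
  "j_of_h = map_option (\<lambda>h. 2 ^ 6 * 3 ^ 3 * h)"

definition hessian_system :: "proj_line \<Rightarrow> proj_line" where
  "hessian_system = inv j_of_h \<circ> hessian_system_j \<circ> j_of_h"

end

theory Submission
  imports Defs
begin

text \<open>
  The two defining properties of the hessian system pin it down: two morphisms of \<open>\<P>\<^sup>1\<close> that agree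
  at infinitely many points coincide (\<open>algebraic_morphism_eqI\<close>). So it suffices to exhibit one
  explicit morphism with these properties, after which the critical points and the fibers are an
  exercise in one variable. The explicit morphism is \<open>h \<mapsto> - (h - 4)\<^sup>3 / (27 h\<^sup>2)\<close>. For it,
  \<open>H'(h) = - (h - 4)\<^sup>2 (h + 8) / (27 h\<^sup>3)\<close> and
  \<open>H(h) - 1 = - (h - 1) (h + 8)\<^sup>2 / (27 h\<^sup>2)\<close>, while in the coordinate \<open>1/h\<close> at infinity \<open>H\<close> reads
  \<open>u \<mapsto> - 27 u / (1 - 4 u)\<^sup>3\<close>; all claims can be read off from these formulas.

  To compute the hessian system, write \<open>W(a, b)\<close> for the Weierstrass cubic. If \<open>a \<noteq> 0\<close>, a linear
  substitution brings \<open>Hess (W(a, b))\<close> back to the Weierstrass form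
  \<open>W(432 (36 b\<^sup>2 - a\<^sup>3), 15552 b (a\<^sup>3 - 24 b\<^sup>2))\<close> (\<open>Hess_weierstrass_cubic_equivalent\<close>). The point
  \<open>[0 : 1 : 0]\<close> makes this possible: it is a flex of the Hessian as well, with tangent \<open>x = 0\<close>, so
  that only the roles of \<open>x\<close> and \<open>z\<close> have to be interchanged and one quadratic term shifted away. If
  \<open>a = 0\<close>, the Hessian is reducible, hence not smooth, and the hessian system is unconstrained there.

  The \<open>j\<close>-invariant is defined through the choice of a Weierstrass form, and one needs that it does
  not depend on this choice. Instead of moving flexes around, the proof uses the pencil spanned by a
  cubic and its Hessian. Taking Hessians commutes with linear changes of coordinates up to scalars
  (\<open>Hess_linear_change\<close>), and for \<open>f = W(a, b)\<close> one finds
  \<open>Hess (s f + t Hess f) = P(s, t) f + Q(s, t) Hess f\<close>, where \<open>P\<close> has the coefficients \<open>2304 a\<close> at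
  \<open>s\<^sup>2 t\<close> and \<open>- 663552 b\<close> at \<open>s t\<^sup>2\<close>. Thus \<open>a\<close> and \<open>b\<close> are, up to constants, the classical
  invariants of degree 4 and 6 of the ternary cubic, and comparing the two expressions for
  equivalent cubics \<open>W(a, b)\<close> and \<open>W(c, d)\<close> gives \<open>a = l\<^sup>2 c\<close> and \<open>b = l\<^sup>3 d\<close> for some \<open>l \<noteq> 0\<close>
  (\<open>weierstrass_coeffs_projectively_equivalent\<close>).
\<close>

text \<open>
  Without its second reading as a coefficient of a power series, the symbol \<open>$\<close> for components of
  vectors is unambiguous; long polynomial expressions would otherwise have exponentially many parses.
\<close>

no_notation fps_nth (infixl \<open>$\<close> 75)

section \<open>Sums over monomials\<close>

text \<open>
  Evaluation and partial derivatives are both sums over the support of a polynomial. The support of a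
  sum can shrink by cancellation, so additivity needs a passage to a common superset.
\<close>

lemma sum_keys_superset:
  fixes f :: ternary_poly and G :: "(3 \<Rightarrow>\<^sub>0 nat) \<Rightarrow> complex \<Rightarrow> 'b :: comm_monoid_add"
  assumes "finite S" "Poly_Mapping.keys f \<subseteq> S" "\<And>m. G m 0 = 0"
  shows "(\<Sum>m\<in>Poly_Mapping.keys f. G m (Poly_Mapping.lookup f m))
       = (\<Sum>m\<in>S. G m (Poly_Mapping.lookup f m))"
  using assms by (intro sum.mono_neutral_left) (auto simp: in_keys_iff)

lemma sum_keys_add:
  fixes f g :: ternary_poly and G :: "(3 \<Rightarrow>\<^sub>0 nat) \<Rightarrow> complex \<Rightarrow> 'b :: comm_monoid_add"
  assumes "\<And>m. G m 0 = 0" and "\<And>m x y. G m (x + y) = G m x + G m y"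
  shows "(\<Sum>m\<in>Poly_Mapping.keys (f + g). G m (Poly_Mapping.lookup (f + g) m))
       = (\<Sum>m\<in>Poly_Mapping.keys f. G m (Poly_Mapping.lookup f m))
       + (\<Sum>m\<in>Poly_Mapping.keys g. G m (Poly_Mapping.lookup g m))"
proof -
  define S where "S = Poly_Mapping.keys f \<union> Poly_Mapping.keys g"
  have "finite S" "Poly_Mapping.keys f \<subseteq> S" "Poly_Mapping.keys g \<subseteq> S"
    "Poly_Mapping.keys (f + g) \<subseteq> S"
    unfolding S_def using keys_add[of f g] by auto
  note superset = sum_keys_superset[where S = S and G = G, OF \<open>finite S\<close> _ assms(1)]
  show ?thesis
    unfolding superset[OF \<open>Poly_Mapping.keys f \<subseteq> S\<close>] superset[OF \<open>Poly_Mapping.keys g \<subseteq> S\<close>]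
      superset[OF \<open>Poly_Mapping.keys (f + g) \<subseteq> S\<close>]
    by (simp add: lookup_add assms(2) sum.distrib)
qed

lemma ternary_poly_induct [case_names monomial add]:
  fixes f :: ternary_poly
  assumes "\<And>m c. P (Poly_Mapping.single m c)" and "\<And>f g. P f \<Longrightarrow> P g \<Longrightarrow> P (f + g)"
  shows "P f"
proof (induction f rule: update_induct)
  case const
  show ?case using assms(1)[of 0 0] by simp
next
  case (update f a b)
  have "Poly_Mapping.update a b f = f + Poly_Mapping.single a b"
    using update.hyps
    by (intro poly_mapping_eqI)
       (auto simp: lookup_update lookup_add lookup_single when_def in_keys_iff)
  with update.IH show ?case using assms by simp
qed

section \<open>Evaluation is a ring homomorphism\<close>

lemma eval_poly_single [simp]:
  "eval_poly (Poly_Mapping.single m c) v = c * (\<Prod>i\<in>UNIV. (v $ i) ^ Poly_Mapping.lookup m i)"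
  by (cases "c = 0") (auto simp: eval_poly_def)

lemma eval_poly_add [simp]: "eval_poly (f + g) v = eval_poly f v + eval_poly g v"
  unfolding eval_poly_def by (rule sum_keys_add) (auto simp: algebra_simps)

lemma eval_poly_mult [simp]: "eval_poly (f * g) v = eval_poly f v * eval_poly g v"
proof (induction f rule: ternary_poly_induct)
  case (monomial m c)
  show ?case
    by (induction g rule: ternary_poly_induct)
       (simp_all add: mult_single lookup_add power_add prod.distrib algebra_simps)
qed (simp add: algebra_simps)

lemma eval_poly_const [simp]: "eval_poly (const_poly c) v = c"
  by (simp add: const_poly_def)

lemma eval_poly_var [simp]: "eval_poly (var_poly i) v = v $ i"
proof -
  have "(v $ k) ^ Poly_Mapping.lookup (Poly_Mapping.single i 1) k = (if k = i then v $ i else 1)" for k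
    by (simp add: lookup_single when_def)
  then show ?thesis by (simp add: var_poly_def)
qed

lemma eval_poly_numeral [simp]: "eval_poly (numeral n) v = numeral n"
  unfolding single_numeral[symmetric] by (simp only: eval_poly_single) simp

lemma eval_poly_1 [simp]: "eval_poly 1 v = 1"
  unfolding single_one[symmetric] by (simp only: eval_poly_single) simp

lemma eval_poly_minus [simp]: "eval_poly (- f) v = - eval_poly f v"
  using eval_poly_add[of f "- f" v] by (simp add: eval_poly_def add_eq_0_iff)

lemma eval_poly_diff [simp]: "eval_poly (f - g) v = eval_poly f v - eval_poly g v"
  using eval_poly_add[of f "- g" v] by simp

lemma eval_poly_power [simp]: "eval_poly (f ^ n) v = eval_poly f v ^ n"
  by (induction n) simp_all

section \<open>Partial derivatives and the chain rule\<close>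

lemma partial_deriv_add: "partial_deriv i (f + g) = partial_deriv i f + partial_deriv i g"
  unfolding partial_deriv_def by (rule sum_keys_add) (auto simp: single_add algebra_simps)

lemma partial_deriv_single:
  "partial_deriv i (Poly_Mapping.single m c)
     = Poly_Mapping.single (m - Poly_Mapping.single i 1) (of_nat (Poly_Mapping.lookup m i) * c)"
  by (cases "c = 0") (auto simp: partial_deriv_def)

lemma DERIV_monomial_line:
  fixes p q r u v w c :: complex
  shows "((\<lambda>t. c * ((p + t * u) ^ k * (q + t * v) ^ l * (r + t * w) ^ m)) has_field_derivative
      c * (of_nat k * u * p ^ (k - 1) * q ^ l * r ^ m + of_nat l * v * p ^ k * q ^ (l - 1) * r ^ m
         + of_nat m * w * p ^ k * q ^ l * r ^ (m - 1))) (at 0)"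
proof -
  have line: "((\<lambda>t. (p + t * u) ^ k) has_field_derivative of_nat k * u * p ^ (k - 1)) (at 0)"
    for p u :: complex and k
    by (auto intro!: derivative_eq_intros)
  show ?thesis
    by (rule DERIV_cong[OF DERIV_cmult[OF DERIV_mult[OF DERIV_mult[OF line line] line]]])
       (simp add: algebra_simps)
qed

lemma prod_3: "(\<Prod>i\<in>UNIV. g i) = g 1 * g 2 * g 3" for g :: "3 \<Rightarrow> complex"
  unfolding UNIV_3 by (simp add: ac_simps)

text \<open>
  The link between the formal partial derivatives and calculus. It allows the partial
  derivatives of a polynomial to be computed from its values alone, without a formal
  product rule, and it carries the chain rule.
\<close>

lemma eval_poly_directional_deriv:
  "((\<lambda>t. eval_poly f (v + t *s u)) has_field_derivative
      (\<Sum>i\<in>UNIV. u $ i * eval_poly (partial_deriv i f) v)) (at 0)"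
proof (induction f rule: ternary_poly_induct)
  case (monomial m c)
  let ?m = "Poly_Mapping.lookup m"
  have line: "eval_poly (Poly_Mapping.single m c) (v + t *s u)
      = c * ((v $ 1 + t * u $ 1) ^ ?m 1 * (v $ 2 + t * u $ 2) ^ ?m 2 * (v $ 3 + t * u $ 3) ^ ?m 3)" for t
    by (simp only: eval_poly_single prod_3 vector_add_component vector_smult_component)
  have partials:
    "eval_poly (partial_deriv 1 (Poly_Mapping.single m c)) v
      = of_nat (?m 1) * c * ((v $ 1) ^ (?m 1 - 1) * (v $ 2) ^ ?m 2 * (v $ 3) ^ ?m 3)"
    "eval_poly (partial_deriv 2 (Poly_Mapping.single m c)) v
      = of_nat (?m 2) * c * ((v $ 1) ^ ?m 1 * (v $ 2) ^ (?m 2 - 1) * (v $ 3) ^ ?m 3)"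
    "eval_poly (partial_deriv 3 (Poly_Mapping.single m c)) v
      = of_nat (?m 3) * c * ((v $ 1) ^ ?m 1 * (v $ 2) ^ ?m 2 * (v $ 3) ^ (?m 3 - 1))"
    unfolding partial_deriv_single eval_poly_single prod_3
    by (simp_all add: lookup_minus lookup_single)
  show ?case
    unfolding line sum_3 partials
    by (rule DERIV_cong[OF DERIV_monomial_line]) (simp only: distrib_left mult_ac)
next
  case (add f g)
  show ?case
    using DERIV_add[OF add] by (simp add: partial_deriv_add distrib_left sum.distrib)
qed

lemma sum_axis_mult: "(\<Sum>k\<in>UNIV. axis i 1 $ k * g k) = g i" for g :: "3 \<Rightarrow> complex"
  using exhaust_3[of i] by (auto simp: sum_3 axis_def)

lemma matrix_mult_axis: "((A :: complex ^ 3 ^ 3) *v axis j 1) $ i = A $ i $ j"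
  using sum_axis_mult[of j "\<lambda>k. A $ i $ k"] by (simp add: matrix_vector_mult_def mult.commute)

lemma eval_partial_deriv_eqI:
  assumes "((\<lambda>t. eval_poly f (v + t *s axis i 1)) has_field_derivative D) (at 0)"
  shows "eval_poly (partial_deriv i f) v = D"
  using DERIV_unique[OF eval_poly_directional_deriv assms] by (simp only: sum_axis_mult)

lemma matrix_vector_mult_line:
  "(A :: complex ^ 3 ^ 3) *v (v + t *s u) = A *v v + t *s (A *v u)"
  by (simp add: matrix_vector_right_distrib vector_scalar_commute)

text \<open>
  The chain rule for linear substitutions, for a whole combination of polynomials at once: used with
  a single polynomial it transforms gradients, and used for the resulting combination of first
  partial derivatives it transforms Hesse matrices.
\<close>

lemma eval_partial_deriv_linear_change:
  fixes A :: "complex ^ 3 ^ 3"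
  assumes "\<And>v. (\<Sum>k\<in>S. w k * eval_poly (f k) (A *v v)) = c * eval_poly g v"
  shows "(\<Sum>k\<in>S. w k * (\<Sum>i\<in>UNIV. A $ i $ j * eval_poly (partial_deriv i (f k)) (A *v v)))
       = c * eval_poly (partial_deriv j g) v"
proof -
  have lhs: "((\<lambda>t. \<Sum>k\<in>S. w k * eval_poly (f k) (A *v (v + t *s axis j 1))) has_field_derivative
        (\<Sum>k\<in>S. w k * (\<Sum>i\<in>UNIV. A $ i $ j * eval_poly (partial_deriv i (f k)) (A *v v)))) (at 0)"
    unfolding matrix_vector_mult_line matrix_mult_axis[symmetric]
    by (rule DERIV_sum, rule DERIV_cmult, rule eval_poly_directional_deriv)
  have rhs: "((\<lambda>t. c * eval_poly g (v + t *s axis j 1)) has_field_derivative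
        c * eval_poly (partial_deriv j g) v) (at 0)"
    using DERIV_cmult[OF eval_poly_directional_deriv[of g v "axis j 1"], of c]
    unfolding sum_axis_mult .
  show ?thesis
    by (rule DERIV_unique[OF lhs[unfolded assms] rhs])
qed

section \<open>The Hessian under linear changes of coordinates\<close>

lemma eval_poly_Hess:
  "eval_poly (Hess f) v = det (\<chi> i j. eval_poly (partial_deriv i (partial_deriv j f)) v)"
  by (simp add: Hess_def det_3)

lemma gradient_linear_change:
  fixes A :: "complex ^ 3 ^ 3"
  assumes "\<And>v. eval_poly f (A *v v) = c * eval_poly g v"
  shows "(\<Sum>i\<in>UNIV. A $ i $ j * eval_poly (partial_deriv i f) (A *v v)) = c * eval_poly (partial_deriv j g) v"
  using eval_partial_deriv_linear_change[where S = "{()}" and w = "\<lambda>_. 1"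
      and f = "\<lambda>_. f" and A = A] assms
  by simp

text \<open>
  Differentiating \<open>f (A v) = c g(v)\<close> twice gives \<open>A\<^sup>T M A = c N\<close> for the Hesse matrices \<open>M\<close> of \<open>f\<close> at
  \<open>A v\<close> and \<open>N\<close> of \<open>g\<close> at \<open>v\<close>; then take determinants.
\<close>

lemma Hess_linear_change:
  fixes A :: "complex ^ 3 ^ 3"
  assumes "\<And>v. eval_poly f (A *v v) = c * eval_poly g v"
  shows "det A ^ 2 * eval_poly (Hess f) (A *v v) = c ^ 3 * eval_poly (Hess g) v"
proof -
  define M where "M = (\<chi> i j. eval_poly (partial_deriv i (partial_deriv j f)) (A *v v))"
  define N where "N = (\<chi> i j. eval_poly (partial_deriv i (partial_deriv j g)) v)"
  have "(\<Sum>k\<in>UNIV. A $ k $ j * (\<Sum>i\<in>UNIV. A $ i $ l * M $ i $ k)) = c * N $ l $ j" for j l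
    unfolding M_def N_def vec_lambda_beta
    by (rule eval_partial_deriv_linear_change) (rule gradient_linear_change[OF assms])
  then have "transpose A ** M ** A = (\<chi> i j. c * N $ i $ j)"
    by (simp add: vec_eq_iff matrix_matrix_mult_def transpose_def mult.commute)
  then have "det (transpose A ** M ** A) = c ^ 3 * det N"
    by (simp add: det_3 power3_eq_cube algebra_simps)
  then have "det A ^ 2 * det M = c ^ 3 * det N"
    by (simp add: det_mul power2_eq_square mult_ac)
  then show ?thesis by (simp add: eval_poly_Hess M_def N_def)
qed

section \<open>Projective equivalence\<close>

lemma projectively_equivalent_refl: "projectively_equivalent f f"
  unfolding projectively_equivalent_def
  by (rule exI[of _ "mat 1"], rule exI[of _ 1]) (simp add: invertible_def exI[of _ "mat 1"])

lemma projectively_equivalent_sym: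
  assumes "projectively_equivalent f g"
  shows "projectively_equivalent g f"
proof -
  obtain A c where A: "invertible A" "c \<noteq> 0" "\<And>v. eval_poly f (A *v v) = c * eval_poly g v"
    using assms unfolding projectively_equivalent_def by auto
  obtain B where B: "A ** B = mat 1" "B ** A = mat 1"
    using A(1) unfolding invertible_def by auto
  have "eval_poly g (B *v v) = (1 / c) * eval_poly f v" for v
    using A(2) A(3)[of "B *v v"] by (simp add: matrix_vector_mul_assoc B)
  moreover have "invertible B" using B unfolding invertible_def by auto
  ultimately show ?thesis
    using A(2) unfolding projectively_equivalent_def
    by (intro exI[of _ B] exI[of _ "1 / c"]) auto
qed

lemma projectively_equivalent_trans:
  assumes "projectively_equivalent f g" "projectively_equivalent g h"
  shows "projectively_equivalent f h"
proof -
  obtain A c where A: "invertible A" "c \<noteq> 0" "\<And>v. eval_poly f (A *v v) = c * eval_poly g v"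
    using assms(1) unfolding projectively_equivalent_def by auto
  obtain B d where B: "invertible B" "d \<noteq> 0" "\<And>v. eval_poly g (B *v v) = d * eval_poly h v"
    using assms(2) unfolding projectively_equivalent_def by auto
  have "eval_poly f ((A ** B) *v v) = (c * d) * eval_poly h v" for v
    by (simp add: matrix_vector_mul_assoc[symmetric] A(3) B(3))
  then show ?thesis
    using A B invertible_mult[of A B] unfolding projectively_equivalent_def
    by (intro exI[of _ "A ** B"] exI[of _ "c * d"]) auto
qed

lemma projectively_equivalent_Hess:
  assumes "projectively_equivalent f g"
  shows "projectively_equivalent (Hess f) (Hess g)"
proof -
  obtain A c where A: "invertible A" "c \<noteq> 0" "\<And>v. eval_poly f (A *v v) = c * eval_poly g v"
    using assms unfolding projectively_equivalent_def by auto
  have det: "det A \<noteq> 0" using A(1) by (simp add: invertible_det_nz)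
  have "eval_poly (Hess f) (A *v v) = (c ^ 3 / det A ^ 2) * eval_poly (Hess g) v" for v
    using Hess_linear_change[OF A(3), of v] det by (simp add: field_simps)
  then show ?thesis
    using A det unfolding projectively_equivalent_def
    by (intro exI[of _ A] exI[of _ "c ^ 3 / det A ^ 2"]) auto
qed

lemma smooth_cubic_projectively_equivalent:
  assumes "homogeneous 3 f" "projectively_equivalent f g" "smooth_cubic g"
  shows "smooth_cubic f"
proof -
  obtain A c where A: "invertible A" "c \<noteq> 0" "\<And>v. eval_poly f (A *v v) = c * eval_poly g v"
    using assms unfolding projectively_equivalent_def by auto
  obtain B where B: "A ** B = mat 1"
    using A(1) unfolding invertible_def by auto
  have "v = 0" if v: "eval_poly f v = 0" "\<And>i. eval_poly (partial_deriv i f) v = 0" for v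
  proof -
    \<comment> \<open>The linear map carries singular points to singular points.\<close>
    define w where "w = B *v v"
    have w: "v = A *v w" by (simp add: w_def matrix_vector_mul_assoc B)
    have "eval_poly g w = 0" using A(2) A(3)[of w] v(1) by (simp add: w)
    moreover have "eval_poly (partial_deriv j g) w = 0" for j
      using A(2) gradient_linear_change[OF A(3), of j w] v(2) by (simp add: w)
    ultimately have "w = 0" using assms(3) unfolding smooth_cubic_def by blast
    then show ?thesis by (simp add: w)
  qed
  then show ?thesis using assms(1) unfolding smooth_cubic_def by blast
qed

section \<open>Homogeneity\<close>

lemma homogeneous_add: "homogeneous d f \<Longrightarrow> homogeneous d g \<Longrightarrow> homogeneous d (f + g)"
  using keys_add[of f g] unfolding homogeneous_def by blast

lemma homogeneous_minus: "homogeneous d f \<Longrightarrow> homogeneous d (- f)"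
  unfolding homogeneous_def by simp

lemma homogeneous_diff: "homogeneous d f \<Longrightarrow> homogeneous d g \<Longrightarrow> homogeneous d (f - g)"
  using homogeneous_add[OF _ homogeneous_minus, of d f g] by simp

lemma homogeneous_mult: "homogeneous d f \<Longrightarrow> homogeneous e g \<Longrightarrow> homogeneous (d + e) (f * g)"
  using keys_mult[of f g] unfolding homogeneous_def
  by (fastforce simp: lookup_add sum.distrib)

lemma homogeneous_const: "homogeneous 0 (const_poly c)"
  unfolding homogeneous_def const_poly_def by (cases "c = 0") auto

lemma homogeneous_var: "homogeneous 1 (var_poly i)"
  unfolding homogeneous_def var_poly_def by (simp add: lookup_single when_def)

lemma homogeneous_numeral: "homogeneous 0 (numeral n)"
  using homogeneous_const[of "numeral n"] by (simp add: const_poly_def single_numeral)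

lemma homogeneous_power: "homogeneous d f \<Longrightarrow> homogeneous (n * d) (f ^ n)"
proof (induction n)
  case 0
  show ?case using homogeneous_const[of 1] by (simp add: const_poly_def)
next
  case (Suc n)
  then show ?case using homogeneous_mult[of d f "n * d" "f ^ n"] by simp
qed

lemma homogeneous_sum: "(\<And>x. x \<in> S \<Longrightarrow> homogeneous d (f x)) \<Longrightarrow> homogeneous d (\<Sum>x\<in>S. f x)"
proof (induction S rule: infinite_finite_induct)
  case (insert x S)
  then show ?case by (simp add: homogeneous_add)
qed (simp_all add: homogeneous_def)

lemma homogeneous_partial_deriv:
  assumes "homogeneous d f"
  shows "homogeneous (d - 1) (partial_deriv i f)"
  unfolding partial_deriv_def
proof (rule homogeneous_sum)
  fix m assume m: "m \<in> Poly_Mapping.keys f"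
  then have d: "(\<Sum>k\<in>UNIV. Poly_Mapping.lookup m k) = d"
    using assms unfolding homogeneous_def by simp
  show "homogeneous (d - 1) (Poly_Mapping.single (m - Poly_Mapping.single i 1)
      (of_nat (Poly_Mapping.lookup m i) * Poly_Mapping.lookup f m))"
  proof (cases "Poly_Mapping.lookup m i = 0")
    case False
    then have "(\<Sum>k\<in>UNIV. Poly_Mapping.lookup (m - Poly_Mapping.single i 1) k) = d - 1"
      using d exhaust_3[of i] by (auto simp: sum_3 lookup_minus lookup_single)
    then show ?thesis unfolding homogeneous_def by simp
  qed (simp add: homogeneous_def)
qed

lemma homogeneous_Hess:
  assumes "homogeneous 3 f"
  shows "homogeneous 3 (Hess f)"
proof -
  have "homogeneous 1 (partial_deriv i (partial_deriv j f))" for i j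
    using homogeneous_partial_deriv[OF homogeneous_partial_deriv[OF assms]] by simp
  then have "homogeneous 3 (partial_deriv i (partial_deriv j f) * partial_deriv k (partial_deriv l f)
      * partial_deriv m (partial_deriv n f))" for i j k l m n
    using homogeneous_mult[OF homogeneous_mult] by (metis numeral_3_eq_3 One_nat_def add_Suc_right add_0_right)
  then show ?thesis
    unfolding Hess_def det_3 vec_lambda_beta by (intro homogeneous_add homogeneous_diff)
qed

section \<open>Cubics in the pencil spanned by a Weierstrass cubic and its Hessian\<close>

text \<open>
  The general cubic form invariant under \<open>y \<mapsto> - y\<close>. Weierstrass cubics have this symmetry, hence so
  do their Hessians and all members of the pencil that they span; a single computation of the Hessian
  therefore serves all of them.
\<close>

definition even_cubic_value ::
  "complex \<Rightarrow> complex \<Rightarrow> complex \<Rightarrow> complex \<Rightarrow> complex \<Rightarrow> complex \<Rightarrow> complex ^ 3 \<Rightarrow> complex" where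
  "even_cubic_value A B C D E F v =
     A * (v $ 2) ^ 2 * v $ 3 + B * (v $ 1) ^ 3 + C * v $ 1 * (v $ 3) ^ 2 + D * (v $ 3) ^ 3
     + E * v $ 1 * (v $ 2) ^ 2 + F * (v $ 1) ^ 2 * v $ 3"

context
  fixes f :: ternary_poly and A B C D E F :: complex
  assumes val: "\<And>v. eval_poly f v = even_cubic_value A B C D E F v"
begin

lemma even_cubic_partials:
  "eval_poly (partial_deriv 1 f) v
     = 3 * B * (v $ 1) ^ 2 + C * (v $ 3) ^ 2 + E * (v $ 2) ^ 2 + 2 * F * v $ 1 * v $ 3"
  "eval_poly (partial_deriv 2 f) v = 2 * A * v $ 2 * v $ 3 + 2 * E * v $ 1 * v $ 2"
  "eval_poly (partial_deriv 3 f) v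
     = A * (v $ 2) ^ 2 + 2 * C * v $ 1 * v $ 3 + 3 * D * (v $ 3) ^ 2 + F * (v $ 1) ^ 2"
  by (rule eval_partial_deriv_eqI;
      auto intro!: derivative_eq_intros simp: val even_cubic_value_def axis_def)+

lemma even_cubic_second_partials:
  "eval_poly (partial_deriv 1 (partial_deriv 1 f)) v = 6 * B * v $ 1 + 2 * F * v $ 3"
  "eval_poly (partial_deriv 1 (partial_deriv 2 f)) v = 2 * E * v $ 2"
  "eval_poly (partial_deriv 1 (partial_deriv 3 f)) v = 2 * C * v $ 3 + 2 * F * v $ 1"
  "eval_poly (partial_deriv 2 (partial_deriv 1 f)) v = 2 * E * v $ 2"
  "eval_poly (partial_deriv 2 (partial_deriv 2 f)) v = 2 * A * v $ 3 + 2 * E * v $ 1"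
  "eval_poly (partial_deriv 2 (partial_deriv 3 f)) v = 2 * A * v $ 2"
  "eval_poly (partial_deriv 3 (partial_deriv 1 f)) v = 2 * C * v $ 3 + 2 * F * v $ 1"
  "eval_poly (partial_deriv 3 (partial_deriv 2 f)) v = 2 * A * v $ 2"
  "eval_poly (partial_deriv 3 (partial_deriv 3 f)) v = 2 * C * v $ 1 + 6 * D * v $ 3"
  by (rule eval_partial_deriv_eqI;
      auto intro!: derivative_eq_intros simp: even_cubic_partials axis_def)+

lemma even_cubic_Hess:
  "eval_poly (Hess f) v =
     (6 * B * v $ 1 + 2 * F * v $ 3) *
       ((2 * A * v $ 3 + 2 * E * v $ 1) * (2 * C * v $ 1 + 6 * D * v $ 3) - (2 * A * v $ 2) ^ 2)
     - (2 * E * v $ 2) ^ 2 * (2 * C * v $ 1 + 6 * D * v $ 3)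
     + 2 * (2 * E * v $ 2) * (2 * A * v $ 2) * (2 * C * v $ 3 + 2 * F * v $ 1)
     - (2 * C * v $ 3 + 2 * F * v $ 1) ^ 2 * (2 * A * v $ 3 + 2 * E * v $ 1)"
proof -
  have symmetric_det: "p * q * r + u * w * s + s * u * w - p * w * w - u * u * r - s * q * s
      = p * (q * r - w ^ 2) - u ^ 2 * r + 2 * u * w * s - s ^ 2 * q" for p q r u w s :: complex
    by (simp add: power2_eq_square algebra_simps)
  show ?thesis
    unfolding eval_poly_Hess det_3 vec_lambda_beta even_cubic_second_partials
    by (rule symmetric_det)
qed

end

lemma eval_weierstrass_cubic:
  "eval_poly (weierstrass_cubic a b) v = even_cubic_value 1 (- 4) a b 0 0 v"
  by (simp add: weierstrass_cubic_def Let_def even_cubic_value_def)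

lemma eval_Hess_weierstrass_cubic:
  "eval_poly (Hess (weierstrass_cubic a b)) v
     = even_cubic_value 0 0 (- 288 * b) (- 8 * a ^ 2) 96 (- 96 * a) v"
  unfolding even_cubic_Hess[OF eval_weierstrass_cubic] even_cubic_value_def
  by (simp add: power2_eq_square power3_eq_cube algebra_simps)

text \<open>
  The Hessian of a member of the pencil spanned by a cubic and its Hessian lies in the same pencil.
  For the invariance of \<open>j\<close> it matters that \<open>a\<close> and \<open>b\<close> can be recovered from the coefficients of \<open>s\<^sup>2 t\<close> and \<open>s t\<^sup>2\<close>
  in front of the cubic.
\<close>

lemma Hess_weierstrass_pencil:
  "eval_poly (Hess (const_poly s * weierstrass_cubic a b + const_poly t * Hess (weierstrass_cubic a b))) v
     = (2304 * a * s ^ 2 * t - 663552 * b * s * t ^ 2 + 1769472 * a ^ 2 * t ^ 3)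
         * eval_poly (weierstrass_cubic a b) v
     + (s ^ 3 - 2304 * a * s * t ^ 2 + 221184 * b * t ^ 3)
         * eval_poly (Hess (weierstrass_cubic a b)) v"
proof -
  have "eval_poly (const_poly s * weierstrass_cubic a b + const_poly t * Hess (weierstrass_cubic a b)) v
      = even_cubic_value s (- 4 * s) (s * a - 288 * b * t) (s * b - 8 * a ^ 2 * t) (96 * t) (- 96 * a * t) v"
    for v
    by (simp add: eval_weierstrass_cubic eval_Hess_weierstrass_cubic even_cubic_value_def algebra_simps)
  note even_cubic_Hess[OF this, of v]
  then show ?thesis
    unfolding eval_weierstrass_cubic eval_Hess_weierstrass_cubic even_cubic_value_def
    by (simp add: power2_eq_square power3_eq_cube algebra_simps)
qed

section \<open>The j-invariant of a Weierstrass cubic is a projective invariant\<close>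

text \<open>
  The linear map that carries one cubic to the other up to the factor \<open>k\<close> carries its Hessian to the
  other Hessian up to a factor \<open>\<mu>\<close>, hence respects the pencils. Taking Hessians of corresponding
  members and comparing coefficients, first in the pencil and then in its parameter, yields the
  relations, with \<open>l = \<mu> / k\<close>.
\<close>

lemma weierstrass_coeffs_projectively_equivalent:
  assumes "projectively_equivalent (weierstrass_cubic a b) (weierstrass_cubic c d)"
  shows "\<exists>l. l \<noteq> 0 \<and> a = l ^ 2 * c \<and> b = l ^ 3 * d"
proof -
  let ?f = "weierstrass_cubic a b" and ?g = "weierstrass_cubic c d"
  obtain A k where A: "invertible A" "k \<noteq> 0" "\<And>v. eval_poly ?f (A *v v) = k * eval_poly ?g v"
    using assms unfolding projectively_equivalent_def by auto
  define \<delta> where "\<delta> = det A ^ 2"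
  define \<mu> where "\<mu> = k ^ 3 / \<delta>"
  have \<delta>: "\<delta> \<noteq> 0" using A(1) by (simp add: \<delta>_def invertible_det_nz)
  have \<mu>: "\<mu> \<noteq> 0" "\<mu> * \<delta> = k ^ 3" using A(2) \<delta> by (simp_all add: \<mu>_def)
  have hess: "eval_poly (Hess ?f) (A *v v) = \<mu> * eval_poly (Hess ?g) v" for v
    using Hess_linear_change[OF A(3), of v] \<delta> by (simp add: \<mu>_def \<delta>_def[symmetric] field_simps)
  define p q P Q where
    "p t = 2304 * a * t - 663552 * b * t ^ 2 + 1769472 * a ^ 2 * t ^ 3" and
    "q t = 1 - 2304 * a * t ^ 2 + 221184 * b * t ^ 3" and
    "P t = 2304 * c * k ^ 2 * (t * \<mu>) - 663552 * d * k * (t * \<mu>) ^ 2 + 1769472 * c ^ 2 * (t * \<mu>) ^ 3" and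
    "Q t = k ^ 3 - 2304 * c * k * (t * \<mu>) ^ 2 + 221184 * d * (t * \<mu>) ^ 3" for t
  have pencil: "\<delta> * (p t * (k * eval_poly ?g v) + q t * (\<mu> * eval_poly (Hess ?g) v))
      = P t * eval_poly ?g v + Q t * eval_poly (Hess ?g) v" for t v
  proof -
    \<comment> \<open>Corresponding members of the two pencils: \<open>A\<close> carries \<open>f + t Hess f\<close> to \<open>k g + t \<mu> Hess g\<close>.\<close>
    let ?F = "const_poly 1 * ?f + const_poly t * Hess ?f"
    let ?G = "const_poly k * ?g + const_poly (t * \<mu>) * Hess ?g"
    have "eval_poly ?F (A *v v) = 1 * eval_poly ?G v" for v
      by (simp add: A(3) hess)
    from Hess_linear_change[OF this, of v] show ?thesis
      unfolding Hess_weierstrass_pencil A(3) hess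
      by (simp add: \<delta>_def p_def q_def P_def Q_def)
  qed
  have coeff: "\<delta> * k * p t = P t" for t
  proof -
    define \<alpha> where "\<alpha> = \<delta> * k * p t - P t"
    define \<beta> where "\<beta> = \<delta> * \<mu> * q t - Q t"
    have lin: "\<alpha> * eval_poly ?g v + \<beta> * eval_poly (Hess ?g) v = 0" for v
      using pencil[of t v] by (simp add: \<alpha>_def \<beta>_def algebra_simps)
    \<comment> \<open>At the point \<open>(0, 1, z)\<close> the combination is \<open>\<alpha> z + (\<alpha> d - 8 c\<^sup>2 \<beta>) z\<^sup>3\<close>; two values of
      \<open>z\<close> already force both coefficients to vanish.\<close>
    have "\<alpha> + (\<alpha> * d - 8 * c ^ 2 * \<beta>) = 0" "2 * \<alpha> + 8 * (\<alpha> * d - 8 * c ^ 2 * \<beta>) = 0"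
      using lin[of "vector [0, 1, 1]"] lin[of "vector [0, 1, 2]"]
      by (simp_all add: eval_weierstrass_cubic eval_Hess_weierstrass_cubic even_cubic_value_def
          algebra_simps)
    then have "\<alpha> = 0" by algebra
    then show ?thesis by (simp add: \<alpha>_def)
  qed
  define \<alpha>\<^sub>1 where "\<alpha>\<^sub>1 = 2304 * k * (a * \<delta> - c * k * \<mu>)"
  define \<alpha>\<^sub>2 where "\<alpha>\<^sub>2 = 663552 * k * (b * \<delta> - d * \<mu> ^ 2)"
  define \<alpha>\<^sub>3 where "\<alpha>\<^sub>3 = 1769472 * (a ^ 2 * \<delta> * k - c ^ 2 * \<mu> ^ 3)"
  have cubic: "\<alpha>\<^sub>1 * t - \<alpha>\<^sub>2 * t ^ 2 + \<alpha>\<^sub>3 * t ^ 3 = 0" for t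
    using coeff[of t] unfolding p_def P_def \<alpha>\<^sub>1_def \<alpha>\<^sub>2_def \<alpha>\<^sub>3_def
    by (simp add: power2_eq_square power3_eq_cube algebra_simps)
  have "\<alpha>\<^sub>1 - \<alpha>\<^sub>2 + \<alpha>\<^sub>3 = 0" "- \<alpha>\<^sub>1 - \<alpha>\<^sub>2 - \<alpha>\<^sub>3 = 0" "2 * \<alpha>\<^sub>1 - 4 * \<alpha>\<^sub>2 + 8 * \<alpha>\<^sub>3 = 0"
    using cubic[of 1] cubic[of "- 1"] cubic[of 2] by (simp_all add: mult.commute)
  then have "\<alpha>\<^sub>1 = 0" "\<alpha>\<^sub>2 = 0" by algebra+
  then have ab: "a * \<delta> = c * k * \<mu>" "b * \<delta> = d * \<mu> ^ 2"
    using A(2) by (simp_all add: \<alpha>\<^sub>1_def \<alpha>\<^sub>2_def)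
  have "a * k ^ 2 = c * \<mu> ^ 2"
  proof -
    have "(a * k ^ 2) * k = (c * \<mu> ^ 2) * k" using ab(1) \<mu>(2) by algebra
    then show ?thesis using A(2) by simp
  qed
  moreover have "b * k ^ 3 = d * \<mu> ^ 3" using ab(2) \<mu>(2) by algebra
  ultimately show ?thesis
    using A(2) \<mu>(1) by (intro exI[of _ "\<mu> / k"]) (simp add: field_simps)
qed

section \<open>Weierstrass form of the Hessian\<close>

lemma smooth_weierstrass_cubic:
  assumes "a ^ 3 - 27 * b ^ 2 \<noteq> 0"
  shows "smooth_cubic (weierstrass_cubic a b)"
proof -
  have "homogeneous 3 (weierstrass_cubic a b)"
  proof -
    have mult: "homogeneous 3 (f * g)" if "homogeneous d f" "homogeneous e g" "d + e = 3" for d e f g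
      using homogeneous_mult[OF that(1,2)] that(3) by simp
    have power: "homogeneous n (var_poly i ^ n)" for n i
      using homogeneous_power[OF homogeneous_var, of n i] by simp
    have var_const: "homogeneous 1 (const_poly c * var_poly i)" for c i
      using homogeneous_mult[OF homogeneous_const homogeneous_var] by simp
    show ?thesis
      unfolding weierstrass_cubic_def Let_def
      by (intro homogeneous_diff mult[OF power homogeneous_var] mult[OF homogeneous_numeral power]
          mult[OF var_const power] mult[OF homogeneous_const power]) simp_all
  qed
  moreover have "v = 0" if sing: "\<And>i. eval_poly (partial_deriv i (weierstrass_cubic a b)) v = 0" for v
  proof -
    define x y z where "x = v $ 1" and "y = v $ 2" and "z = v $ 3"
    have eqs: "a * z ^ 2 = 12 * x ^ 2" "y * z = 0" "y ^ 2 + 2 * a * x * z + 3 * b * z ^ 2 = 0"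
      using sing[of 1] sing[of 2] sing[of 3]
      by (simp_all add: even_cubic_partials[OF eval_weierstrass_cubic] x_def y_def z_def algebra_simps)
    have "z = 0"
    proof (rule ccontr)
      assume z: "z \<noteq> 0"
      have "y = 0" using eqs(2) z by simp
      have "z * (2 * a * x + 3 * b * z) = 0" using eqs(3) \<open>y = 0\<close> by algebra
      then have "2 * a * x + 3 * b * z = 0" using z by simp
      then have "(a ^ 3 - 27 * b ^ 2) * z ^ 2 = 0" using eqs(1) by algebra
      with z assms show False by simp
    qed
    then have "x = 0" "y = 0" using eqs by auto
    with \<open>z = 0\<close> show "v = 0" by (simp add: vec_eq_iff forall_3 x_def y_def z_def)
  qed
  ultimately show ?thesis unfolding smooth_cubic_def by blast
qed

text \<open>
  For \<open>a = 0\<close> the Hessian is a multiple of \<open>x (y\<^sup>2 - 3 b z\<^sup>2)\<close>: three lines, which meet in singular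
  points.
\<close>

lemma Hess_weierstrass_equianharmonic_singular: "\<not> smooth_cubic (Hess (weierstrass_cubic 0 b))"
proof
  assume smooth: "smooth_cubic (Hess (weierstrass_cubic 0 b))"
  \<comment> \<open>A common point of the lines \<open>x = 0\<close> and \<open>y = sqrt (3 b) z\<close>.\<close>
  define v :: "complex ^ 3" where "v = vector [0, csqrt (3 * b), 1]"
  have v: "v $ 1 = 0" "v $ 3 = 1" "(v $ 2) ^ 2 = 3 * b" by (simp_all add: v_def)
  have "eval_poly (Hess (weierstrass_cubic 0 b)) v = 0"
    by (simp add: eval_Hess_weierstrass_cubic even_cubic_value_def v)
  moreover have "eval_poly (partial_deriv i (Hess (weierstrass_cubic 0 b))) v = 0" for i
    using exhaust_3[of i]
    by (auto simp: even_cubic_partials[OF eval_Hess_weierstrass_cubic] v)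
  moreover have "v \<noteq> 0" using v(2) by auto
  ultimately show False using smooth unfolding smooth_cubic_def by blast
qed

text \<open>
  Weierstrass coefficients of the Hessian are determined only up to replacing \<open>(g\<^sub>2, g\<^sub>3)\<close> by
  \<open>(l\<^sup>2 g\<^sub>2, l\<^sup>3 g\<^sub>3)\<close>; this choice has integer coefficients as a polynomial in \<open>a\<close> and \<open>b\<close>.
\<close>

definition hess_g2 :: "complex \<Rightarrow> complex \<Rightarrow> complex" where
  "hess_g2 a b = 432 * (36 * b ^ 2 - a ^ 3)"

definition hess_g3 :: "complex \<Rightarrow> complex \<Rightarrow> complex" where
  "hess_g3 a b = 15552 * b * (a ^ 3 - 24 * b ^ 2)"

text \<open>
  The factorization shows that the Hessian of a smooth Weierstrass cubic is smooth as soon as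
  \<open>a \<noteq> 0\<close>. It is also what turns the quotient defining the new \<open>j\<close>-invariant into a rational function
  of the old one.
\<close>

lemma hess_discriminant:
  "hess_g2 a b ^ 3 - 27 * hess_g3 a b ^ 2 = - (432 ^ 3 * a ^ 6 * (a ^ 3 - 27 * b ^ 2))"
  unfolding hess_g2_def hess_g3_def by algebra

text \<open>
  Up to the factor 8, the Hessian is \<open>12 x y\<^sup>2 - 12 a x\<^sup>2 z - 36 b x z\<^sup>2 - a\<^sup>2 z\<^sup>3\<close>, that is, the linear
  form \<open>x\<close> times \<open>y\<^sup>2\<close> plus a cubic in \<open>x\<close> and \<open>z\<close> with nonzero coefficient at \<open>z\<^sup>3\<close>. So \<open>x\<close> takes over
  the role of \<open>z\<close>, and \<open>z\<close>, shifted so as to remove the quadratic term, that of \<open>x\<close>.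
\<close>

lemma Hess_weierstrass_cubic_equivalent:
  assumes "a \<noteq> 0"
  shows "projectively_equivalent (Hess (weierstrass_cubic a b)) (weierstrass_cubic (hess_g2 a b) (hess_g3 a b))"
proof -
  \<comment> \<open>The shift by \<open>- 36 b\<close> removes the quadratic term; the factors \<open>3 a\<^sup>2\<close> and \<open>1/12\<close> make the ratio of the
    coefficients of \<open>y\<^sup>2 z\<close> and \<open>x\<^sup>3\<close> equal to \<open>1 : - 4\<close>.\<close>
  define A :: "complex ^ 3 ^ 3" where
    "A = vector [vector [0, 0, 3 * a ^ 2], vector [0, 1 / 12, 0], vector [1, 0, - 36 * b]]"
  have "det A = - (a ^ 2) / 4" by (simp add: det_3 A_def)
  then have "invertible A" using assms by (simp add: invertible_det_nz)
  moreover have "eval_poly (Hess (weierstrass_cubic a b)) (A *v v)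
      = 2 * a ^ 2 * eval_poly (weierstrass_cubic (hess_g2 a b) (hess_g3 a b)) v" for v
  proof -
    define x y z where "x = v $ 1" and "y = v $ 2" and "z = v $ 3"
    have coords: "(A *v v) $ 1 = 3 * a ^ 2 * z" "(A *v v) $ 2 = y / 12" "(A *v v) $ 3 = x - 36 * b * z"
      by (simp_all add: A_def matrix_vector_mult_def sum_3 x_def y_def z_def)
    show ?thesis
      unfolding eval_Hess_weierstrass_cubic eval_weierstrass_cubic even_cubic_value_def coords
        hess_g2_def hess_g3_def
      by (simp add: x_def[symmetric] y_def[symmetric] z_def[symmetric]
          power2_eq_square power3_eq_cube algebra_simps)
  qed
  ultimately show ?thesis
    using assms unfolding projectively_equivalent_def
    by (intro exI[of _ A] exI[of _ "2 * a ^ 2"]) auto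
qed

section \<open>Morphisms of the projective line agreeing at infinitely many points\<close>

lemma eval_binary_form_affine: "t \<noteq> 0 \<Longrightarrow> Polynomial.degree p \<le> d \<Longrightarrow>
    eval_binary_form d p s t = t ^ d * poly p (s / t)"
proof -
  assume t: "t \<noteq> 0" and deg: "Polynomial.degree p \<le> d"
  have "poly p (s / t) = (\<Sum>i\<le>d. poly.coeff p i * (s / t) ^ i)"
    using arg_cong[OF poly_as_sum_of_monoms'[OF deg], of "\<lambda>p. poly p (s / t)"]
    by (simp add: poly_sum poly_monom)
  with t show ?thesis
    by (simp add: eval_binary_form_def sum_distrib_left power_divide power_diff mult_ac)
qed

lemma eval_binary_form_at_infinity: "eval_binary_form d p s 0 = poly.coeff p d * s ^ d"
proof -
  have "(0::complex) ^ (d - i) = (if i = d then 1 else 0)" if "i \<le> d" for i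
    using that by (auto simp: power_0_left)
  then have "eval_binary_form d p s 0 = (\<Sum>i\<le>d. if i = d then poly.coeff p d * s ^ d else 0)"
    unfolding eval_binary_form_def by (intro sum.cong) auto
  then show ?thesis by simp
qed

lemma proj_point_eq_iff:
  assumes "(x, y) \<noteq> (0, 0)" "(x', y') \<noteq> (0, 0)"
  shows "proj_point x y = proj_point x' y' \<longleftrightarrow> x * y' = x' * y"
  using assms by (auto simp: proj_point_def field_simps)

text \<open>
  Multiplicativity at the point at infinity: the top coefficient of a homogenized product is the
  product of the top coefficients, also if the degrees are smaller than those of the forms.
\<close>

lemma coeff_mult_top:
  fixes p q :: "complex poly"
  assumes "Polynomial.degree p \<le> m" "Polynomial.degree q \<le> n"
  shows "poly.coeff (p * q) (m + n) = poly.coeff p m * poly.coeff q n"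
proof (cases "Polynomial.degree p = m \<and> Polynomial.degree q = n")
  case True
  then show ?thesis using coeff_mult_degree_sum[of p q] by auto
next
  case False
  then have "Polynomial.degree (p * q) < m + n"
    using assms degree_mult_le[of p q] by linarith
  with False assms show ?thesis by (auto simp: coeff_eq_0)
qed

text \<open>
  Agreement at a point \<open>x\<close> means that \<open>p q' - p' q\<close> vanishes at \<open>x\<close>. A polynomial with infinitely
  many roots is zero, so the corresponding binary forms are proportional at every point of \<open>\<P>\<^sup>1\<close>,
  including infinity.
\<close>

lemma algebraic_morphism_eqI:
  assumes F: "algebraic_morphism F" and G: "algebraic_morphism G"
    and inf: "infinite S" and eq: "\<And>x. x \<in> S \<Longrightarrow> F (Some x) = G (Some x)"
  shows "F = G"
proof
  obtain d p q where deg: "Polynomial.degree p \<le> d" "Polynomial.degree q \<le> d"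
    and pq: "\<And>s t. (s, t) \<noteq> (0, 0) \<Longrightarrow> (eval_binary_form d p s t, eval_binary_form d q s t) \<noteq> (0, 0)"
    and Fpq: "\<And>s t. (s, t) \<noteq> (0, 0) \<Longrightarrow>
        F (proj_point s t) = proj_point (eval_binary_form d p s t) (eval_binary_form d q s t)"
    using F unfolding algebraic_morphism_def by metis
  obtain d' p' q' where deg': "Polynomial.degree p' \<le> d'" "Polynomial.degree q' \<le> d'"
    and pq': "\<And>s t. (s, t) \<noteq> (0, 0) \<Longrightarrow> (eval_binary_form d' p' s t, eval_binary_form d' q' s t) \<noteq> (0, 0)"
    and Gpq: "\<And>s t. (s, t) \<noteq> (0, 0) \<Longrightarrow>
        G (proj_point s t) = proj_point (eval_binary_form d' p' s t) (eval_binary_form d' q' s t)"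
    using G unfolding algebraic_morphism_def by metis
  have "poly (p * q' - p' * q) x = 0" if "x \<in> S" for x
  proof -
    have "proj_point (poly p x) (poly q x) = proj_point (poly p' x) (poly q' x)"
      using Fpq[of x 1] Gpq[of x 1] eq[OF that] deg deg'
      by (simp add: eval_binary_form_affine proj_point_def[of _ 1])
    then show ?thesis
      using pq[of x 1] pq'[of x 1] deg deg' by (simp add: eval_binary_form_affine proj_point_eq_iff)
  qed
  then have "S \<subseteq> {x. poly (p * q' - p' * q) x = 0}" by auto
  with inf have "p * q' - p' * q = 0"
    using poly_roots_finite finite_subset by metis
  then have cross: "p * q' = p' * q" by simp
  have forms: "eval_binary_form d p s t * eval_binary_form d' q' s t
      = eval_binary_form d' p' s t * eval_binary_form d q s t" for s t
  proof (cases "t = 0")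
    case True
    have "poly.coeff p d * poly.coeff q' d' = poly.coeff p' d' * poly.coeff q d"
      using coeff_mult_top[OF deg(1) deg'(2)] coeff_mult_top[OF deg'(1) deg(2)] cross
      by (simp add: add.commute)
    with True show ?thesis by (simp add: eval_binary_form_at_infinity algebra_simps)
  next
    case False
    have "poly p (s / t) * poly q' (s / t) = poly p' (s / t) * poly q (s / t)"
      using cross by (metis poly_mult)
    with False deg deg' show ?thesis by (simp add: eval_binary_form_affine algebra_simps)
  qed
  fix P :: proj_line
  obtain s t where st: "(s, t) \<noteq> (0, 0)" "P = proj_point s t"
  proof (cases P)
    case None
    then show thesis using that[of 1 0] by (simp add: proj_point_def)
  next
    case (Some a)
    then show thesis using that[of a 1] by (simp add: proj_point_def)
  qed
  show "F P = G P"
    unfolding st(2) Fpq[OF st(1)] Gpq[OF st(1)]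
    by (rule iffD2[OF proj_point_eq_iff[OF pq[OF st(1)] pq'[OF st(1)]] forms])
qed

section \<open>The explicit map and its identification with the hessian system\<close>

text \<open>
  At \<open>h = 0\<close> the second homogeneous coordinate vanishes and the first does not, so the value there is
  infinity. The two maps are the same one in the coordinates \<open>h\<close> and \<open>j = 1728 h\<close>.
\<close>

definition hessian_map_h :: "proj_line \<Rightarrow> proj_line" where
  "hessian_map_h P = (case P of None \<Rightarrow> None | Some h \<Rightarrow> proj_point (- ((h - 4) ^ 3)) (27 * h ^ 2))"

definition hessian_map_j :: "proj_line \<Rightarrow> proj_line" where
  "hessian_map_j P = (case P of None \<Rightarrow> None | Some j \<Rightarrow> proj_point (- ((j - 6912) ^ 3)) (27 * j ^ 2))"

lemma algebraic_morphism_hessian_map_j: "algebraic_morphism hessian_map_j"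
proof -
  define p :: "complex poly" where "p = [:6912 ^ 3, - 3 * 6912 ^ 2, 3 * 6912, - 1:]"
  define q :: "complex poly" where "q = [:0, 0, 27:]"
  have p: "eval_binary_form 3 p s t = - ((s - 6912 * t) ^ 3)" for s t
    by (simp add: eval_binary_form_def p_def numeral_eq_Suc algebra_simps)
  have q: "eval_binary_form 3 q s t = 27 * s ^ 2 * t" for s t
    by (simp add: eval_binary_form_def q_def numeral_eq_Suc)
  have "hessian_map_j (proj_point s t) = proj_point (- ((s - 6912 * t) ^ 3)) (27 * s ^ 2 * t)" for s t
  proof (cases "t = 0 \<or> s = 0")
    case True
    then show ?thesis by (auto simp: hessian_map_j_def proj_point_def)
  next
    case False
    then show ?thesis
      by (simp add: hessian_map_j_def proj_point_def field_simps power2_eq_square power3_eq_cube)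
  qed
  moreover have "(- ((s - 6912 * t) ^ 3), 27 * s ^ 2 * t) \<noteq> (0, 0)" if "(s, t) \<noteq> (0, 0)" for s t :: complex
    using that by auto
  ultimately show ?thesis
    unfolding algebraic_morphism_def
    by (intro exI[of _ 3] exI[of _ p] exI[of _ q]) (simp_all add: p q, simp_all add: p_def q_def)
qed

lemma hessian_map_h_conj: "inv j_of_h \<circ> hessian_map_j \<circ> j_of_h = hessian_map_h"
proof -
  have inj: "inj j_of_h"
    unfolding j_of_h_def by (intro option.inj_map injI) simp
  have "hessian_map_j (j_of_h P) = j_of_h (hessian_map_h P)" for P
  proof (cases P)
    case (Some h)
    have "- ((1728 * h - 6912) ^ 3) / (27 * (1728 * h) ^ 2) = 1728 * (- ((h - 4) ^ 3) / (27 * h ^ 2))"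
    proof -
      have eq: "1728 * h - 6912 = 1728 * (h - 4)" by simp
      show ?thesis unfolding eq power_mult_distrib by simp
    qed
    with Some show ?thesis
      by (auto simp: j_of_h_def hessian_map_j_def hessian_map_h_def proj_point_def)
  qed (simp add: j_of_h_def hessian_map_j_def hessian_map_h_def)
  then show ?thesis
    using inv_f_f[OF inj] by (auto simp: fun_eq_iff)
qed

text \<open>
  With \<open>D = a\<^sup>3 - 27 b\<^sup>2\<close> and \<open>N = 36 b\<^sup>2 - a\<^sup>3\<close> one has \<open>j - 6912 = 5184 N / D\<close>, and both sides become
  \<open>- 1728 N\<^sup>3 / (a\<^sup>6 D)\<close>.
\<close>

lemma hessian_map_j_weierstrass:
  assumes "a \<noteq> 0" "a ^ 3 - 27 * b ^ 2 \<noteq> 0"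
  shows "hessian_map_j (Some (1728 * a ^ 3 / (a ^ 3 - 27 * b ^ 2)))
     = Some (1728 * hess_g2 a b ^ 3 / (hess_g2 a b ^ 3 - 27 * hess_g3 a b ^ 2))"
proof -
  define D where "D = a ^ 3 - 27 * b ^ 2"
  define N where "N = 36 * b ^ 2 - a ^ 3"
  define j where "j = 1728 * a ^ 3 / D"
  have D: "D \<noteq> 0" using assms by (simp add: D_def)
  have "j \<noteq> 0" using assms D by (simp add: j_def)
  have "1728 * a ^ 3 - 6912 * D = 5184 * N" by (simp add: D_def N_def)
  then have shift: "j - 6912 = 5184 * N / D"
    using D by (simp add: j_def divide_diff_eq_iff)
  have "- ((j - 6912) ^ 3) / (27 * j ^ 2) = - (1728 * N ^ 3 / (a ^ 6 * D))"
    unfolding shift unfolding j_def using assms(1) D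
    by (simp add: power_divide power_mult_distrib divide_simps)
       (simp add: power2_eq_square power3_eq_cube)
  moreover have "1728 * hess_g2 a b ^ 3 / (hess_g2 a b ^ 3 - 27 * hess_g3 a b ^ 2)
      = - (1728 * N ^ 3 / (a ^ 6 * D))"
    unfolding hess_discriminant unfolding hess_g2_def D_def[symmetric] N_def[symmetric]
    by (simp add: power_mult_distrib)
  ultimately show ?thesis
    using \<open>j \<noteq> 0\<close> by (simp add: hessian_map_j_def proj_point_def j_def D_def)
qed

lemma is_hessian_system_hessian_map_j: "is_hessian_system hessian_map_j"
  unfolding is_hessian_system_def
proof (intro conjI allI impI)
  fix f j j'
  assume smooth: "smooth_cubic (Hess f)" and j: "has_j_invariant f j" and j': "has_j_invariant (Hess f) j'"
  obtain a b where ab: "a ^ 3 - 27 * b ^ 2 \<noteq> 0" "projectively_equivalent f (weierstrass_cubic a b)"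
      "j = 1728 * a ^ 3 / (a ^ 3 - 27 * b ^ 2)"
    using j unfolding has_j_invariant_def by (elim exE conjE) (rule that)
  obtain c d where cd: "c ^ 3 - 27 * d ^ 2 \<noteq> 0" "projectively_equivalent (Hess f) (weierstrass_cubic c d)"
      "j' = 1728 * c ^ 3 / (c ^ 3 - 27 * d ^ 2)"
    using j' unfolding has_j_invariant_def by (elim exE conjE) (rule that)
  have hess: "projectively_equivalent (Hess (weierstrass_cubic a b)) (Hess f)"
    by (rule projectively_equivalent_sym[OF projectively_equivalent_Hess[OF ab(2)]])
  have "homogeneous 3 (Hess (weierstrass_cubic a b))"
    using smooth_weierstrass_cubic[OF ab(1)] homogeneous_Hess unfolding smooth_cubic_def by blast
  then have "smooth_cubic (Hess (weierstrass_cubic a b))"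
    by (rule smooth_cubic_projectively_equivalent[OF _ hess smooth])
  then have a: "a \<noteq> 0" using Hess_weierstrass_equianharmonic_singular by auto
  have "projectively_equivalent (weierstrass_cubic (hess_g2 a b) (hess_g3 a b)) (weierstrass_cubic c d)"
    by (rule projectively_equivalent_trans[OF
          projectively_equivalent_sym[OF Hess_weierstrass_cubic_equivalent[OF a]]
          projectively_equivalent_trans[OF hess cd(2)]])
  then obtain l where l: "l \<noteq> 0" "hess_g2 a b = l ^ 2 * c" "hess_g3 a b = l ^ 3 * d"
    using weierstrass_coeffs_projectively_equivalent by blast
  have num: "hess_g2 a b ^ 3 = l ^ 6 * c ^ 3" and den: "hess_g2 a b ^ 3 - 27 * hess_g3 a b ^ 2 = l ^ 6 * (c ^ 3 - 27 * d ^ 2)"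
    unfolding l(2,3) by algebra+
  have "1728 * hess_g2 a b ^ 3 / (hess_g2 a b ^ 3 - 27 * hess_g3 a b ^ 2) = j'"
    unfolding cd(3) den unfolding num using l(1) by simp
  then show "hessian_map_j (Some j) = Some j'"
    using hessian_map_j_weierstrass[OF a ab(1)] ab(3) by simp
qed (rule algebraic_morphism_hessian_map_j)

text \<open>
  Uniqueness needs enough cubics to which the defining property applies. The Weierstrass cubics with
  \<open>g\<^sub>2 = g\<^sub>3 = g\<close> suffice: their invariant is \<open>1728 g / (g - 27)\<close>, which is solved for \<open>g\<close> without
  extracting roots.
\<close>

lemma hessian_system_value_ex:
  assumes "j \<noteq> 0" "j \<noteq> 1728"
  shows "\<exists>f j'. smooth_cubic f \<and> smooth_cubic (Hess f) \<and> has_j_invariant f j \<and> has_j_invariant (Hess f) j'"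
proof -
  define g where "g = 27 * j / (j - 1728)"
  have g: "g \<noteq> 0" using assms by (simp add: g_def)
  have g27: "g - 27 = 46656 / (j - 1728)" using assms by (simp add: g_def field_simps)
  have disc: "g ^ 3 - 27 * g ^ 2 = g ^ 2 * (g - 27)" by algebra
  have nz: "g ^ 3 - 27 * g ^ 2 \<noteq> 0" unfolding disc g27 using g assms by simp
  let ?f = "weierstrass_cubic g g"
  have "1728 * g ^ 3 / (g ^ 3 - 27 * g ^ 2) = 1728 * g / (g - 27)"
    unfolding disc using g by (simp add: power2_eq_square power3_eq_cube)
  also have "\<dots> = j" unfolding g27 using assms by (simp add: g_def)
  finally have "has_j_invariant ?f j"
    using nz projectively_equivalent_refl unfolding has_j_invariant_def by metis
  moreover have disc': "hess_g2 g g ^ 3 - 27 * hess_g3 g g ^ 2 \<noteq> 0"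
    unfolding hess_discriminant using nz g by simp
  then have "has_j_invariant (Hess ?f) (1728 * hess_g2 g g ^ 3 / (hess_g2 g g ^ 3 - 27 * hess_g3 g g ^ 2))"
    using Hess_weierstrass_cubic_equivalent[OF g] unfolding has_j_invariant_def by blast
  moreover have smooth: "smooth_cubic ?f" by (rule smooth_weierstrass_cubic[OF nz])
  moreover have "smooth_cubic (Hess ?f)"
  proof (rule smooth_cubic_projectively_equivalent)
    show "homogeneous 3 (Hess ?f)"
      using smooth homogeneous_Hess unfolding smooth_cubic_def by blast
  qed (rule Hess_weierstrass_cubic_equivalent[OF g] smooth_weierstrass_cubic[OF disc'])+
  ultimately show ?thesis by blast
qed

lemma is_hessian_system_unique:
  assumes F: "is_hessian_system F" and G: "is_hessian_system G"
  shows "F = G"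
proof (rule algebraic_morphism_eqI)
  show "algebraic_morphism F" "algebraic_morphism G"
    using F G unfolding is_hessian_system_def by auto
  show "infinite (- {0, 1728 :: complex})"
    by (simp add: Compl_eq_Diff_UNIV infinite_UNIV_char_0)
  fix j :: complex assume "j \<in> - {0, 1728}"
  then obtain f j' where "smooth_cubic f" "smooth_cubic (Hess f)" "has_j_invariant f j" "has_j_invariant (Hess f) j'"
    using hessian_system_value_ex[of j] by auto
  then show "F (Some j) = G (Some j)"
    using F G unfolding is_hessian_system_def by metis
qed

lemma hessian_system_eq: "hessian_system = hessian_map_h"
proof -
  have "hessian_system_j = hessian_map_j"
    unfolding hessian_system_j_def
    using is_hessian_system_hessian_map_j is_hessian_system_unique by (intro the_equality) auto
  then show ?thesis by (simp add: hessian_system_def hessian_map_h_conj)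
qed

section \<open>Ramification of the explicit map\<close>

lemma local_expr_finite:
  assumes "a \<noteq> 0" "t \<noteq> - a"
  shows "local_expr hessian_map_h (Some a) t
     = - ((a + t - 4) ^ 3) / (27 * (a + t) ^ 2) + (a - 4) ^ 3 / (27 * a ^ 2)"
proof -
  have "a + t \<noteq> 0" using assms(2) by (metis add_eq_0_iff minus_minus add.commute)
  then show ?thesis
    using assms(1) by (simp add: local_expr_def hessian_map_h_def proj_point_def)
qed

text \<open>
  At the two points over infinity the formulas also hold where the denominator vanishes: the local
  coordinate at infinity takes the value 0 there by division by zero, as does the right-hand side.
\<close>

lemma local_expr_zero:
  "local_expr hessian_map_h (Some 0) t = - (27 * t ^ 2) / (t - 4) ^ 3"
  by (simp add: local_expr_def hessian_map_h_def proj_point_def)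

lemma local_expr_infty:
  "local_expr hessian_map_h infty t = - (27 * t) / (1 - 4 * t) ^ 3"
proof (cases "t = 0")
  case False
  have eq: "1 / t - 4 = (1 - 4 * t) / t" using False by (simp add: field_simps)
  show ?thesis
    using False
    by (simp add: local_expr_def hessian_map_h_def proj_point_def eq power_divide)
       (simp add: power2_eq_square power3_eq_cube mult.assoc)
qed (simp add: local_expr_def hessian_map_h_def proj_point_def)

lemma deriv_local_expr_finite:
  assumes "a \<noteq> 0"
  shows "deriv (local_expr hessian_map_h (Some a)) 0 = - ((a - 4) ^ 2) * (a + 8) / (27 * a ^ 3)"
proof -
  have "\<forall>\<^sub>F t in nhds 0. t \<in> - {- a}"
    using assms by (intro eventually_nhds_in_open) auto
  then have ev: "\<forall>\<^sub>F t in nhds 0. local_expr hessian_map_h (Some a) t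
      = - ((a + t - 4) ^ 3) / (27 * (a + t) ^ 2) + (a - 4) ^ 3 / (27 * a ^ 2)"
    by eventually_elim (use assms local_expr_finite in auto)
  have "- (3 * (a - 4) ^ 2) * (27 * a ^ 2) + (a - 4) ^ 3 * (54 * a)
      = - ((a - 4) ^ 2) * (a + 8) * (27 * a)"
    by (simp add: power2_eq_square power3_eq_cube algebra_simps)
  moreover have "(27 * a ^ 2) * (27 * a ^ 2) = 27 * a ^ 3 * (27 * a)"
    by (simp add: power2_eq_square power3_eq_cube)
  ultimately have "(- (3 * (a - 4) ^ 2) * (27 * a ^ 2) + (a - 4) ^ 3 * (54 * a))
      / ((27 * a ^ 2) * (27 * a ^ 2))
      = (- ((a - 4) ^ 2) * (a + 8) * (27 * a)) / (27 * a ^ 3 * (27 * a))"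
    by (simp only:)
  also have "\<dots> = - ((a - 4) ^ 2) * (a + 8) / (27 * a ^ 3)"
    by (rule nonzero_mult_divide_mult_cancel_right) (use assms in simp)
  finally have quotient: "(- (3 * (a - 4) ^ 2) * (27 * a ^ 2) + (a - 4) ^ 3 * (54 * a))
      / ((27 * a ^ 2) * (27 * a ^ 2)) = - ((a - 4) ^ 2) * (a + 8) / (27 * a ^ 3)" .
  have num: "((\<lambda>t. - ((a + t - 4) ^ 3)) has_field_derivative - (3 * (a - 4) ^ 2)) (at 0)"
    by (auto intro!: derivative_eq_intros)
  have den: "((\<lambda>t. 27 * (a + t) ^ 2) has_field_derivative 54 * a) (at 0)"
    by (auto intro!: derivative_eq_intros)
  have "((\<lambda>t. - ((a + t - 4) ^ 3) / (27 * (a + t) ^ 2)) has_field_derivative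
      (- (3 * (a - 4) ^ 2) * (27 * a ^ 2) + (a - 4) ^ 3 * (54 * a)) / ((27 * a ^ 2) * (27 * a ^ 2))) (at 0)"
    using DERIV_divide[OF num den] assms by simp
  then have "((\<lambda>t. - ((a + t - 4) ^ 3) / (27 * (a + t) ^ 2) + (a - 4) ^ 3 / (27 * a ^ 2))
      has_field_derivative - ((a - 4) ^ 2) * (a + 8) / (27 * a ^ 3) + 0) (at 0)"
    unfolding quotient by (rule DERIV_add) (rule DERIV_const)
  then have "((\<lambda>t. - ((a + t - 4) ^ 3) / (27 * (a + t) ^ 2) + (a - 4) ^ 3 / (27 * a ^ 2))
      has_field_derivative - ((a - 4) ^ 2) * (a + 8) / (27 * a ^ 3)) (at 0)"
    by simp
  then show ?thesis
    unfolding deriv_cong_ev[OF ev refl] by (rule DERIV_imp_deriv)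
qed

lemma deriv_local_expr_zero: "deriv (local_expr hessian_map_h (Some 0)) 0 = 0"
  unfolding local_expr_zero[abs_def]
  by (rule DERIV_imp_deriv) (auto intro!: derivative_eq_intros)

lemma deriv_local_expr_infty: "deriv (local_expr hessian_map_h infty) 0 = - 27"
  unfolding local_expr_infty[abs_def]
  by (rule DERIV_imp_deriv) (auto intro!: derivative_eq_intros)

lemma critical_locus_hessian_map: "critical_locus hessian_map_h = {Some 4, Some (-8), Some 0}"
proof -
  have "deriv (local_expr hessian_map_h P) 0 = 0 \<longleftrightarrow> P \<in> {Some 4, Some (-8), Some 0}" for P
  proof (cases P)
    case None
    then show ?thesis by (simp add: deriv_local_expr_infty)
  next
    case (Some a)
    show ?thesis
    proof (cases "a = 0")
      case True
      with Some show ?thesis by (simp add: deriv_local_expr_zero)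
    next
      case False
      with Some show ?thesis
        by (simp add: deriv_local_expr_finite add_eq_0_iff2)
    qed
  qed
  then show ?thesis unfolding critical_locus_def by blast
qed

lemma discriminant_locus_hessian_map:
  "discriminant_locus hessian_map_h = {Some 0, Some 1, infty}"
  unfolding discriminant_locus_def critical_locus_hessian_map
  by (auto simp: hessian_map_h_def proj_point_def)

section \<open>Fibers\<close>

lemma fiber_0_iff: "hessian_map_h P = Some 0 \<longleftrightarrow> P = Some 4"
  by (cases P) (auto simp: hessian_map_h_def proj_point_def)

lemma fiber_1_iff: "hessian_map_h P = Some 1 \<longleftrightarrow> P = Some (-8) \<or> P = Some 1"
proof (cases P)
  case (Some h)
  have "27 * h ^ 2 - - ((h - 4) ^ 3) = (h - 1) * (h + 8) ^ 2"
    by (simp add: power2_eq_square power3_eq_cube algebra_simps)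
  then have "- ((h - 4) ^ 3) = 27 * h ^ 2 \<longleftrightarrow> (h - 1) * (h + 8) ^ 2 = 0"
    using eq_iff_diff_eq_0[of "27 * h ^ 2" "- ((h - 4) ^ 3)"] by argo
  then have "- ((h - 4) ^ 3) = 27 * h ^ 2 \<longleftrightarrow> h = -8 \<or> h = 1"
    by (auto simp: eq_neg_iff_add_eq_0)
  moreover have "hessian_map_h (Some h) = Some 1 \<longleftrightarrow> h \<noteq> 0 \<and> - ((h - 4) ^ 3) = 27 * h ^ 2"
    by (simp add: hessian_map_h_def proj_point_def divide_eq_1_iff del: divide_minus_left)
  ultimately show ?thesis
    using Some by auto
qed (simp add: hessian_map_h_def)

lemma fiber_infty_iff: "hessian_map_h P = infty \<longleftrightarrow> P = Some 0 \<or> P = infty"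
  by (cases P) (auto simp: hessian_map_h_def proj_point_def)

lemma zorder_local_expr_4: "zorder (local_expr hessian_map_h (Some 4)) 0 = 3"
proof (rule zorder_eqI[where S = "- {-4}" and g = "\<lambda>t. - 1 / (27 * (4 + t) ^ 2)"])
  show "(\<lambda>t. - 1 / (27 * (4 + t) ^ 2)) holomorphic_on - {-4 :: complex}"
    by (intro holomorphic_intros) (auto simp: add_eq_0_iff)
  fix t :: complex assume "t \<in> - {- 4}"
  then show "local_expr hessian_map_h (Some 4) t = - 1 / (27 * (4 + t) ^ 2) * (t - 0) powi 3"
    by (simp add: local_expr_finite power_int_def)
qed auto

lemma zorder_local_expr_m8: "zorder (local_expr hessian_map_h (Some (-8))) 0 = 2"
proof (rule zorder_eqI[where S = "- {8}" and g = "\<lambda>t. - (t - 9) / (27 * (t - 8) ^ 2)"])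
  fix t :: complex assume t: "t \<in> - {8}"
  then have nz: "27 * (t - 8) ^ 2 \<noteq> 0" by simp
  with t have "local_expr hessian_map_h (Some (-8)) t
      = - ((t - 12) ^ 3) / (27 * (t - 8) ^ 2) - 1"
    by (simp add: local_expr_finite)
  also have "- ((t - 12) ^ 3) / (27 * (t - 8) ^ 2) - 1
      = (- ((t - 12) ^ 3) - 1 * (27 * (t - 8) ^ 2)) / (27 * (t - 8) ^ 2)"
    by (rule divide_diff_eq_iff[OF nz])
  also have "- ((t - 12) ^ 3) - 1 * (27 * (t - 8) ^ 2) = - (t - 9) * t ^ 2"
    by (simp add: power2_eq_square power3_eq_cube algebra_simps)
  finally show "local_expr hessian_map_h (Some (-8)) t = - (t - 9) / (27 * (t - 8) ^ 2) * (t - 0) powi 2"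
    by (simp add: power_int_def)
qed (auto intro!: holomorphic_intros)

lemma zorder_local_expr_1: "zorder (local_expr hessian_map_h (Some 1)) 0 = 1"
proof (rule zorder_eqI[where S = "- {-1}" and g = "\<lambda>t. - ((t + 9) ^ 2) / (27 * (t + 1) ^ 2)"])
  show "(\<lambda>t. - ((t + 9) ^ 2) / (27 * (t + 1) ^ 2)) holomorphic_on - {-1 :: complex}"
    by (intro holomorphic_intros) (auto simp: add_eq_0_iff2)
  fix t :: complex assume t: "t \<in> - {- 1}"
  then have nz: "27 * (t + 1) ^ 2 \<noteq> 0" by (simp add: eq_neg_iff_add_eq_0)
  with t have "local_expr hessian_map_h (Some 1) t
      = - ((t - 3) ^ 3) / (27 * (t + 1) ^ 2) - 1"
    by (simp add: local_expr_finite add.commute[of 1] eq_neg_iff_add_eq_0)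
  also have "- ((t - 3) ^ 3) / (27 * (t + 1) ^ 2) - 1
      = (- ((t - 3) ^ 3) - 1 * (27 * (t + 1) ^ 2)) / (27 * (t + 1) ^ 2)"
    by (rule divide_diff_eq_iff[OF nz])
  also have "- ((t - 3) ^ 3) - 1 * (27 * (t + 1) ^ 2) = - ((t + 9) ^ 2) * t"
    by (simp add: power2_eq_square power3_eq_cube algebra_simps)
  finally show "local_expr hessian_map_h (Some 1) t = - ((t + 9) ^ 2) / (27 * (t + 1) ^ 2) * (t - 0) powi 1"
    by (simp add: power_int_def)
qed auto

lemma zorder_local_expr_0: "zorder (local_expr hessian_map_h (Some 0)) 0 = 2"
proof (rule zorder_eqI[where S = "- {4}" and g = "\<lambda>t. - 27 / (t - 4) ^ 3"])
  fix t :: complex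
  show "local_expr hessian_map_h (Some 0) t = - 27 / (t - 4) ^ 3 * (t - 0) powi 2"
    by (simp add: local_expr_zero power_int_def)
qed (auto intro!: holomorphic_intros)

lemma zorder_local_expr_infty: "zorder (local_expr hessian_map_h infty) 0 = 1"
proof (rule zorder_eqI[where S = "- {1 / 4}" and g = "\<lambda>t. - 27 / (1 - 4 * t) ^ 3"])
  fix t :: complex
  show "local_expr hessian_map_h infty t = - 27 / (1 - 4 * t) ^ 3 * (t - 0) powi 1"
    by (simp add: local_expr_infty power_int_def)
qed (auto intro!: holomorphic_intros simp: nonzero_eq_divide_eq mult.commute)

lemma fiber_divisor_eqI:
  assumes "\<And>a. Poly_Mapping.lookup D a = (if F a = c then zorder (local_expr F a) 0 else 0)"
  shows "fiber_divisor F c = D"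
  unfolding fiber_divisor_def assms[symmetric] by (rule lookup_inverse)

lemma fiber_divisor_0:
  "fiber_divisor hessian_map_h (Some 0) = frag_cmul 3 (frag_of (Some 4))"
  by (rule fiber_divisor_eqI) (simp add: fiber_0_iff zorder_local_expr_4)

lemma fiber_divisor_1:
  "fiber_divisor hessian_map_h (Some 1) = frag_cmul 2 (frag_of (Some (-8))) + frag_of (Some 1)"
  by (rule fiber_divisor_eqI)
     (auto simp: fiber_1_iff lookup_add zorder_local_expr_m8 zorder_local_expr_1)

lemma fiber_divisor_infty:
  "fiber_divisor hessian_map_h infty = frag_cmul 2 (frag_of (Some 0)) + frag_of infty"
  by (rule fiber_divisor_eqI)
     (auto simp: fiber_infty_iff lookup_add zorder_local_expr_0 zorder_local_expr_infty)

theorem proposition4p1: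
  shows
    "critical_locus hessian_system = {Some 4, Some (-8), Some 0} \<and>
     discriminant_locus hessian_system = {Some 0, Some 1, infty} \<and>
     fiber_divisor hessian_system (Some 0) = frag_cmul 3 (frag_of (Some 4)) \<and>
     fiber_divisor hessian_system (Some 1) =
           frag_cmul 2 (frag_of (Some (-8))) + frag_of (Some 1) \<and>
     fiber_divisor hessian_system infty =
           frag_cmul 2 (frag_of (Some 0)) + frag_of infty"
  unfolding hessian_system_eq
  by (intro conjI critical_locus_hessian_map discriminant_locus_hessian_map
      fiber_divisor_0 fiber_divisor_1 fiber_divisor_infty)

end
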